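(* Let $\Gamma_0\subset\Gamma_1\subset\Gamma_2$ be elliptic graphs such that for $k\in\{0,1\}$, $\Gamma_{k+1}$ is obtained from $\Gamma_k$ by attaching finitely many (at least one) new vertices, each joined by a single edge only to one fixed end-vertex of $\Gamma_k$. Let $\check\ell\in Supp(\check P_0^{\Gamma_0})$ and assume $\check\pi_{(\Gamma_0,\Gamma_2)}^{-1}(\check\ell)\neq\emptyset$. Let $NE$ be the set of those $\check\ell_1\in\check\pi^{-1}_{(\Gamma_0,\Gamma_1)}(\check\ell)$ with $\check\pi^{-1}_{(\Gamma_1,\Gamma_2)}(\check\ell_1)=\emptyset$. Then $$\sum_{\check\ell_1\in NE}z^{\Gamma_1}(\check\ell_1)=0.$$
   Context: For a decorated tree $G$ (vertex set $\mathcal V(G)$, integer decorations $e_v$, genera zero, negative definite form on $L(G)=\mathbb Z\langle E_v\rangle$ with $(E_v,E_v)=e_v$, $(E_v,E_w)=1$ for adjacent $v\ne w$, $0$ otherwise) let $L'(G)$ be its dual lattice, $E_v^*$ with $(E_v^*,E_w)=-\delta_{vw}$, $\delta_v$ the valency, $E^G=\sum E_v$, $Z_K^G$ with $(Z_K^G,E_v)=e_v+2$, $\chi(l')=-(l',l'-Z_K^G)/2$; $\ge$ coordinatewise, $\prec$ strict in all coordinates, $l>0$ if $l\ge0,l\ne0$. $Z^G(\mathbf t)=\sum z^G(l')\mathbf t^{l'}$ is the Taylor expansion at $0$ of $\prod_v(1-\mathbf t^{E_v^*})^{\delta_v-2}$. $Supp(\check P_0^G)=\{Z^G_K-E^G-\ell:\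 \ell\in L(G),\ \ell\not\prec0,\ z^G(Z^G_K-E^G-\ell)\ne0\}$. $G$ is elliptic if $e_v\le-2$ for all $v$ and $\min_{l\in L(G),l>0}\chi(l)=0$. An end-vertex is a vertex of valency 1. For connected full subgraphs $\Gamma'\subset\Gamma''$, $\check\pi_{(\Gamma',\Gamma'')}(x)=Z_K^{\Gamma'}-E^{\Gamma'}-(Z_K^{\Gamma''}-E^{\Gamma''}-x)|_{\Gamma'}$ (restriction of coefficients to vertices of $\Gamma'$), and $\check\pi^{-1}_{(\Gamma',\Gamma'')}(y)=\{x\in Supp(\check P_0^{\Gamma''}):\check\pi_{(\Gamma',\Gamma'')}(x)=y\}$. *)

theory Defs
  imports Complex_Main
begin

text \<open>A decorated graph is given by a finite vertex set V, a symmetric irreflexive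
adjacency relation adj and integer decorations e (all genera are zero).
Full subgraphs share adj and e and only shrink the vertex set.
Lattice elements (of L and of L') are rational coefficient vectors with respect to
the basis E_v, i.e. functions 'a => rat vanishing outside V.\<close>

definition imat :: "('a \<Rightarrow> 'a \<Rightarrow> bool) \<Rightarrow> ('a \<Rightarrow> int) \<Rightarrow> 'a \<Rightarrow> 'a \<Rightarrow> rat" where
  "imat adj e v w = (if v = w then of_int (e v) else if adj v w then 1 else 0)"

definition form :: "'a set \<Rightarrow> ('a \<Rightarrow> 'a \<Rightarrow> bool) \<Rightarrow> ('a \<Rightarrow> int) \<Rightarrow> ('a \<Rightarrow> rat) \<Rightarrow> ('a \<Rightarrow> rat) \<Rightarrow> rat" where
  "form V adj e x y = (\<Sum>v\<in>V. \<Sum>w\<in>V. x v * y w * imat adj e v w)"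

definition supported :: "'a set \<Rightarrow> ('a \<Rightarrow> rat) \<Rightarrow> bool" where
  "supported V x \<longleftrightarrow> (\<forall>v. v \<notin> V \<longrightarrow> x v = 0)"

definition latL :: "'a set \<Rightarrow> ('a \<Rightarrow> rat) set" where
  "latL V = {l. supported V l \<and> (\<forall>v\<in>V. l v \<in> \<int>)}"

definition Ebasis :: "'a \<Rightarrow> 'a \<Rightarrow> rat" where
  "Ebasis v = (\<lambda>w. if w = v then 1 else 0)"

definition EG :: "'a set \<Rightarrow> 'a \<Rightarrow> rat" where
  "EG V = (\<lambda>w. if w \<in> V then 1 else 0)"

definition latL' :: "'a set \<Rightarrow> ('a \<Rightarrow> 'a \<Rightarrow> bool) \<Rightarrow> ('a \<Rightarrow> int) \<Rightarrow> ('a \<Rightarrow> rat) set" where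
  "latL' V adj e = {l. supported V l \<and> (\<forall>v\<in>V. form V adj e l (Ebasis v) \<in> \<int>)}"

definition Edual :: "'a set \<Rightarrow> ('a \<Rightarrow> 'a \<Rightarrow> bool) \<Rightarrow> ('a \<Rightarrow> int) \<Rightarrow> 'a \<Rightarrow> 'a \<Rightarrow> rat" where
  "Edual V adj e v = (THE x. supported V x \<and>
      (\<forall>w\<in>V. form V adj e x (Ebasis w) = (if v = w then -1 else 0)))"

definition ZK :: "'a set \<Rightarrow> ('a \<Rightarrow> 'a \<Rightarrow> bool) \<Rightarrow> ('a \<Rightarrow> int) \<Rightarrow> 'a \<Rightarrow> rat" where
  "ZK V adj e = (THE x. supported V x \<and>
      (\<forall>v\<in>V. form V adj e x (Ebasis v) = of_int (e v) + 2))"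

definition chi :: "'a set \<Rightarrow> ('a \<Rightarrow> 'a \<Rightarrow> bool) \<Rightarrow> ('a \<Rightarrow> int) \<Rightarrow> ('a \<Rightarrow> rat) \<Rightarrow> rat" where
  "chi V adj e l = - form V adj e l (l - ZK V adj e) / 2"

definition valency :: "'a set \<Rightarrow> ('a \<Rightarrow> 'a \<Rightarrow> bool) \<Rightarrow> 'a \<Rightarrow> nat" where
  "valency V adj v = card {w\<in>V. adj v w}"

definition edges :: "'a set \<Rightarrow> ('a \<Rightarrow> 'a \<Rightarrow> bool) \<Rightarrow> 'a set set" where
  "edges V adj = {{x, y} | x y. x \<in> V \<and> y \<in> V \<and> adj x y}"

definition negdef :: "'a set \<Rightarrow> ('a \<Rightarrow> 'a \<Rightarrow> bool) \<Rightarrow> ('a \<Rightarrow> int) \<Rightarrow> bool" where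
  "negdef V adj e \<longleftrightarrow> (\<forall>x. supported V x \<and> (\<exists>v\<in>V. x v \<noteq> 0) \<longrightarrow> form V adj e x x < 0)"

definition decorated_tree :: "'a set \<Rightarrow> ('a \<Rightarrow> 'a \<Rightarrow> bool) \<Rightarrow> ('a \<Rightarrow> int) \<Rightarrow> bool" where
  "decorated_tree V adj e \<longleftrightarrow> finite V \<and> V \<noteq> {} \<and>
     (\<forall>x\<in>V. \<forall>y\<in>V. adj x y \<longrightarrow> adj y x) \<and> (\<forall>x\<in>V. \<not> adj x x) \<and>
     (\<forall>x\<in>V. \<forall>y\<in>V. (\<lambda>a b. a \<in> V \<and> b \<in> V \<and> adj a b)\<^sup>*\<^sup>* x y) \<and>
     card (edges V adj) + 1 = card V \<and>
     negdef V adj e"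

definition lpos :: "'a set \<Rightarrow> ('a \<Rightarrow> rat) \<Rightarrow> bool" where
  "lpos V l \<longleftrightarrow> (\<forall>v\<in>V. l v \<ge> 0) \<and> (\<exists>v\<in>V. l v \<noteq> 0)"

definition elliptic :: "'a set \<Rightarrow> ('a \<Rightarrow> 'a \<Rightarrow> bool) \<Rightarrow> ('a \<Rightarrow> int) \<Rightarrow> bool" where
  "elliptic V adj e \<longleftrightarrow> decorated_tree V adj e \<and> (\<forall>v\<in>V. e v \<le> -2) \<and>
     (\<exists>l\<in>latL V. lpos V l \<and> chi V adj e l = 0) \<and>
     (\<forall>l\<in>latL V. lpos V l \<longrightarrow> chi V adj e l \<ge> 0)"

text \<open>Coefficient of x^k in (1-x)^n, n an integer.\<close>
definition zcoef :: "int \<Rightarrow> nat \<Rightarrow> rat" where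
  "zcoef n k = (-1) ^ k * ((of_int n :: rat) gchoose k)"

text \<open>Coefficients of the Taylor expansion of prod_v (1 - t^{E_v^*})^{delta_v - 2}.\<close>
definition zG :: "'a set \<Rightarrow> ('a \<Rightarrow> 'a \<Rightarrow> bool) \<Rightarrow> ('a \<Rightarrow> int) \<Rightarrow> ('a \<Rightarrow> rat) \<Rightarrow> rat" where
  "zG V adj e l' = (\<Sum>k\<in>{k :: 'a \<Rightarrow> nat. (\<forall>v. v \<notin> V \<longrightarrow> k v = 0) \<and>
        (\<lambda>w. \<Sum>v\<in>V. of_nat (k v) * Edual V adj e v w) = l'}.
      \<Prod>v\<in>V. zcoef (int (valency V adj v) - 2) (k v))"

definition suppP0 :: "'a set \<Rightarrow> ('a \<Rightarrow> 'a \<Rightarrow> bool) \<Rightarrow> ('a \<Rightarrow> int) \<Rightarrow> ('a \<Rightarrow> rat) set" where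
  "suppP0 V adj e = {ZK V adj e - EG V - ll | ll. ll \<in> latL V \<and> \<not> (\<forall>v\<in>V. ll v < 0) \<and>
        zG V adj e (ZK V adj e - EG V - ll) \<noteq> 0}"

definition restr :: "'a set \<Rightarrow> ('a \<Rightarrow> rat) \<Rightarrow> 'a \<Rightarrow> rat" where
  "restr V x = (\<lambda>v. if v \<in> V then x v else 0)"

definition piC :: "'a set \<Rightarrow> 'a set \<Rightarrow> ('a \<Rightarrow> 'a \<Rightarrow> bool) \<Rightarrow> ('a \<Rightarrow> int) \<Rightarrow> ('a \<Rightarrow> rat) \<Rightarrow> 'a \<Rightarrow> rat" where
  "piC V' V'' adj e x = ZK V' adj e - EG V' - restr V' (ZK V'' adj e - EG V'' - x)"

definition piC_inv :: "'a set \<Rightarrow> 'a set \<Rightarrow> ('a \<Rightarrow> 'a \<Rightarrow> bool) \<Rightarrow> ('a \<Rightarrow> int) \<Rightarrow> ('a \<Rightarrow> rat) \<Rightarrow> ('a \<Rightarrow> rat) set" where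
  "piC_inv V' V'' adj e y = {x \<in> suppP0 V'' adj e. piC V' V'' adj e x = y}"

definition end_attachment :: "'a set \<Rightarrow> 'a set \<Rightarrow> ('a \<Rightarrow> 'a \<Rightarrow> bool) \<Rightarrow> bool" where
  "end_attachment V V' adj \<longleftrightarrow> V \<subset> V' \<and> finite V' \<and>
     (\<exists>u\<in>V. valency V adj u = 1 \<and> (\<forall>w\<in>V' - V. \<forall>x\<in>V'. adj w x \<longleftrightarrow> x = u))"

end

theory Submission
  imports Defs
begin

text \<open>Since the exponent of \<open>E\<^sub>v\<^sup>*\<close> in \<open>Z\<^sub>K - E - \<ell>\<close> is \<open>\<delta>\<^sub>v - 2 + (\<ell>, E\<^sub>v)\<close>, the number
\<open>z(Z\<^sub>K - E - \<ell>)\<close> is a product of local factors, and \<open>\<pi>\<close> is restriction of \<open>\<ell>\<close>. Gluing \<open>s\<close> vertices to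
an end \<open>u\<close> changes only the factor at \<open>u\<close>, to a coefficient of \<open>(1 - t)\<^sup>s\<^sup>-\<^sup>1\<close>, and bounds each new
coordinate from above. So whether \<open>\<ell>\<^sub>1\<close> extends to \<open>\<Gamma>\<^sub>2\<close> is the condition \<open>N \<ge> 0\<close> on a number \<open>N\<close> that
involves only the coefficients at the second gluing vertex \<open>u'\<close> and its neighbour.
If \<open>u'\<close> lies in \<open>\<Gamma>\<^sub>0\<close>, then \<open>N\<close> is constant on the fibre. Otherwise \<open>N\<close> depends on
\<open>a = \<ell>\<^sub>1(u')\<close> only, and for fixed \<open>a\<close> the sum of \<open>z\<close> over the fibre is a coefficient of
\<open>(1 - t)\<^sup>s\<^sup>-\<^sup>1 / (1 - t)\<^sup>s\<^sup>-\<^sup>1 = 1\<close>, hence vanishes except for one value \<open>a\<^sub>0\<close>. Any point over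
\<open>\<Gamma>\<^sub>2\<close> has \<open>a \<ge> a\<^sub>0\<close> and \<open>N(a) \<ge> 0\<close>; ellipticity of \<open>\<Gamma>\<^sub>0\<close> and \<open>\<Gamma>\<^sub>2\<close> bounds the number of vertices
glued to \<open>u'\<close> by \<open>-e(u')\<close>, which makes \<open>N\<close> nonincreasing, so \<open>N(a\<^sub>0) \<ge> 0\<close> and \<open>a\<^sub>0\<close> does not occur.\<close>

section \<open>Nondegeneracy of the intersection form\<close>

lemma tree_finite: "decorated_tree V adj e \<Longrightarrow> finite V"
  and tree_sym: "decorated_tree V adj e \<Longrightarrow> x \<in> V \<Longrightarrow> y \<in> V \<Longrightarrow> adj x y \<longleftrightarrow> adj y x"
  and tree_irrefl: "decorated_tree V adj e \<Longrightarrow> x \<in> V \<Longrightarrow> \<not> adj x x"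
  and tree_negdef: "decorated_tree V adj e \<Longrightarrow> negdef V adj e"
  unfolding decorated_tree_def by blast+

lemma form_Ebasis:
  assumes "finite V" "v \<in> V"
  shows "form V adj e x (Ebasis v) = (\<Sum>w\<in>V. x w * imat adj e w v)"
proof -
  have "form V adj e x (Ebasis v) = (\<Sum>w\<in>V. \<Sum>w'\<in>V. if w' = v then x w * imat adj e w v else 0)"
    unfolding form_def Ebasis_def by (intro sum.cong refl) auto
  also have "\<dots> = (\<Sum>w\<in>V. x w * imat adj e w v)"
    using assms by (simp add: sum.delta)
  finally show ?thesis .
qed

lemma form_expand_right:
  assumes "finite V"
  shows "form V adj e x y = (\<Sum>w\<in>V. y w * form V adj e x (Ebasis w))"
proof -
  have "form V adj e x y = (\<Sum>w\<in>V. \<Sum>v\<in>V. x v * y w * imat adj e v w)"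
    unfolding form_def by (rule sum.swap)
  also have "\<dots> = (\<Sum>w\<in>V. y w * form V adj e x (Ebasis w))"
    by (intro sum.cong refl) (simp add: form_Ebasis assms sum_distrib_left algebra_simps)
  finally show ?thesis .
qed

lemma form_add_left: "form V adj e (\<lambda>v. x v + c * y v) z = form V adj e x z + c * form V adj e y z"
  unfolding form_def by (simp add: sum.distrib sum_distrib_left algebra_simps)

lemma form_mono_set:
  assumes "finite V'" "V \<subseteq> V'" "supported V x" "supported V y"
  shows "form V' adj e x y = form V adj e x y"
proof -
  have "form V' adj e x y = (\<Sum>v\<in>V. \<Sum>w\<in>V'. x v * y w * imat adj e v w)"
    unfolding form_def using assms by (intro sum.mono_neutral_right) (auto simp: supported_def)
  also have "\<dots> = form V adj e x y"
    unfolding form_def using assms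
    by (intro sum.cong refl sum.mono_neutral_right) (auto simp: supported_def)
  finally show ?thesis .
qed

lemma negdef_subset:
  assumes "finite V'" "V \<subseteq> V'" "negdef V' adj e"
  shows "negdef V adj e"
  unfolding negdef_def
proof (intro allI impI)
  fix x assume x: "supported V x \<and> (\<exists>v\<in>V. x v \<noteq> 0)"
  then have "supported V' x" using assms by (auto simp: supported_def)
  then have "form V' adj e x x < 0" using x assms by (auto simp: negdef_def)
  then show "form V adj e x x < 0" using form_mono_set assms x by metis
qed

text \<open>The difference pairs to zero with every basis vector, hence with itself, and
  definiteness forces it to vanish.\<close>

lemma negdef_nondegenerate:
  assumes "finite V" "negdef V adj e" "supported V x" "supported V y"
    and "\<And>w. w \<in> V \<Longrightarrow> form V adj e x (Ebasis w) = form V adj e y (Ebasis w)"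
  shows "x = y"
proof (rule ccontr)
  assume "x \<noteq> y"
  define d where "d = (\<lambda>v. x v + (-1) * y v)"
  have "supported V d" using assms by (auto simp: d_def supported_def)
  moreover have "\<exists>v\<in>V. d v \<noteq> 0"
    using \<open>x \<noteq> y\<close> assms(3,4) by (fastforce simp: d_def supported_def)
  ultimately have "form V adj e d d < 0" using assms(2) by (auto simp: negdef_def)
  moreover have "form V adj e d (Ebasis w) = 0" if "w \<in> V" for w
    unfolding d_def form_add_left using assms(5)[OF that] by simp
  then have "form V adj e d d = 0" by (simp add: form_expand_right[OF assms(1), of _ _ _ d])
  ultimately show False by simp
qed

text \<open>Gram--Schmidt step: the new vertex is corrected by its projection to the old ones.\<close>
lemma negdef_solvable:
  assumes "finite V" "negdef V adj e"
  shows "\<exists>x. supported V x \<and> (\<forall>v\<in>V. form V adj e x (Ebasis v) = b v)"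
  using assms
proof (induction V arbitrary: b rule: finite_induct)
  case empty
  show ?case by (rule exI[of _ "\<lambda>_. 0"]) (auto simp: supported_def)
next
  case (insert u V)
  let ?U = "insert u V"
  let ?f = "form ?U adj e"
  have fin: "finite ?U" using insert by simp
  have nd: "negdef V adj e" using negdef_subset[OF fin _ insert.prems] by blast
  have eq: "?f x (Ebasis v) = form V adj e x (Ebasis v)" if "supported V x" "v \<in> V" for x v
    using that fin by (intro form_mono_set) (auto simp: supported_def Ebasis_def)
  obtain y where y: "supported V y" "\<And>v. v \<in> V \<Longrightarrow> form V adj e y (Ebasis v) = b v"
    using insert.IH[OF nd, of b] by blast
  obtain z where z: "supported V z"
      "\<And>v. v \<in> V \<Longrightarrow> form V adj e z (Ebasis v) = ?f (Ebasis u) (Ebasis v)"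
    using insert.IH[OF nd, of "\<lambda>v. ?f (Ebasis u) (Ebasis v)"] by blast
  define r where "r = (\<lambda>v. Ebasis u v + (-1) * z v)"
  have ru: "r u = 1" using z insert by (auto simp: r_def Ebasis_def supported_def)
  have r0: "?f r (Ebasis v) = 0" if "v \<in> V" for v
    unfolding r_def form_add_left using that z eq by simp
  have rs: "supported ?U r" using z by (auto simp: r_def supported_def Ebasis_def)
  have "?f r r < 0" using insert.prems rs ru by (auto simp: negdef_def)
  then have rne: "?f r (Ebasis u) \<noteq> 0"
    using r0 insert by (auto simp: form_expand_right[OF fin, of _ _ _ r])
  define t where "t = (b u - ?f y (Ebasis u)) / ?f r (Ebasis u)"
  define x where "x = (\<lambda>v. y v + t * r v)"
  have "supported ?U x" using y rs by (auto simp: x_def supported_def)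
  moreover have "?f x (Ebasis v) = b v" if "v \<in> ?U" for v
    using that rne r0 y eq unfolding x_def form_add_left by (auto simp: t_def)
  ultimately show ?case by blast
qed

text \<open>Gives meaning to the definite descriptions in \<open>ZK\<close> and
  \<open>Edual\<close>.\<close>

lemma negdef_ex1:
  assumes "finite V" "negdef V adj e"
  shows "\<exists>!x. supported V x \<and> (\<forall>v\<in>V. form V adj e x (Ebasis v) = b v)"
  using negdef_solvable[OF assms, of b] negdef_nondegenerate[OF assms] by (metis (no_types, lifting))

lemma ZK_props:
  assumes "finite V" "negdef V adj e"
  shows "supported V (ZK V adj e)"
    and "v \<in> V \<Longrightarrow> form V adj e (ZK V adj e) (Ebasis v) = of_int (e v) + 2"
  using theI'[OF negdef_ex1[OF assms, of "\<lambda>v. of_int (e v) + 2"]] unfolding ZK_def by auto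

lemma Edual_props:
  assumes "finite V" "negdef V adj e"
  shows "supported V (Edual V adj e v)"
    and "w \<in> V \<Longrightarrow> form V adj e (Edual V adj e v) (Ebasis w) = (if v = w then -1 else 0)"
  using theI'[OF negdef_ex1[OF assms, of "\<lambda>w. if v = w then -1 else 0"]] unfolding Edual_def by auto

section \<open>Integral cycles and their local factors\<close>

text \<open>The pairing \<open>(\<ell>, E\<^sub>v)\<close> of an integral cycle, for \<open>v \<in> V\<close>.\<close>
definition pairing :: "'a set \<Rightarrow> ('a \<Rightarrow> 'a \<Rightarrow> bool) \<Rightarrow> ('a \<Rightarrow> int) \<Rightarrow> ('a \<Rightarrow> int) \<Rightarrow> 'a \<Rightarrow> int" where
  "pairing V adj e x v = e v * x v + (\<Sum>w | w \<in> V \<and> adj v w. x w)"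

text \<open>Extension by zero to negative exponents lets the factors themselves encode the condition
  that a monomial occurs.\<close>

definition zc :: "int \<Rightarrow> int \<Rightarrow> rat" where
  "zc n k = (if k < 0 then 0 else zcoef n (nat k))"

text \<open>The second argument of \<open>zc\<close> is the multiplicity of
  \<open>Edual V adj e v\<close> in \<open>dual_point V adj e x\<close>; it may be negative.\<close>

definition vertex_factor :: "'a set \<Rightarrow> ('a \<Rightarrow> 'a \<Rightarrow> bool) \<Rightarrow> ('a \<Rightarrow> int) \<Rightarrow> ('a \<Rightarrow> int) \<Rightarrow> 'a \<Rightarrow> rat" where
  "vertex_factor V adj e x v = zc (int (valency V adj v) - 2) (int (valency V adj v) - 2 + pairing V adj e x v)"

definition weight :: "'a set \<Rightarrow> ('a \<Rightarrow> 'a \<Rightarrow> bool) \<Rightarrow> ('a \<Rightarrow> int) \<Rightarrow> ('a \<Rightarrow> int) \<Rightarrow> rat" where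
  "weight V adj e x = (\<Prod>v\<in>V. vertex_factor V adj e x v)"

definition dual_point :: "'a set \<Rightarrow> ('a \<Rightarrow> 'a \<Rightarrow> bool) \<Rightarrow> ('a \<Rightarrow> int) \<Rightarrow> ('a \<Rightarrow> int) \<Rightarrow> 'a \<Rightarrow> rat" where
  "dual_point V adj e x = ZK V adj e - EG V - (\<lambda>v. of_int (x v))"

definition int_supported :: "'a set \<Rightarrow> ('a \<Rightarrow> int) \<Rightarrow> bool" where
  "int_supported V x \<longleftrightarrow> (\<forall>v. v \<notin> V \<longrightarrow> x v = 0)"

definition int_restr :: "'a set \<Rightarrow> ('a \<Rightarrow> int) \<Rightarrow> 'a \<Rightarrow> int" where
  "int_restr V x = (\<lambda>v. if v \<in> V then x v else 0)"

lemma form_of_int_Ebasis: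
  assumes t: "decorated_tree V adj e" and v: "v \<in> V"
  shows "form V adj e (\<lambda>w. of_int (x w)) (Ebasis v) = of_int (pairing V adj e x v)"
proof -
  have fin: "finite V" using tree_finite[OF t] .
  have "form V adj e (\<lambda>w. of_int (x w)) (Ebasis v) =
      (\<Sum>w\<in>V. (if w = v then of_int (e v * x v) else 0) + (if adj v w then of_int (x w) else 0))"
    unfolding form_Ebasis[OF fin v]
    using tree_sym[OF t] tree_irrefl[OF t] v by (intro sum.cong refl) (auto simp: imat_def)
  also have "\<dots> = of_int (e v * x v) + (\<Sum>w\<in>V. if adj v w then of_int (x w) else 0)"
    using v fin by (simp add: sum.distrib)
  also have "(\<Sum>w\<in>V. if adj v w then of_int (x w) else (0::rat)) = (\<Sum>w | w \<in> V \<and> adj v w. of_int (x w))"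
    using fin by (simp add: sum.inter_filter)
  finally show ?thesis by (simp add: pairing_def)
qed

lemma form_EG_Ebasis:
  assumes t: "decorated_tree V adj e" and v: "v \<in> V"
  shows "form V adj e (EG V) (Ebasis v) = of_int (e v + int (valency V adj v))"
proof -
  have "form V adj e (EG V) (Ebasis v) = form V adj e (\<lambda>w. of_int (if w \<in> V then 1 else 0)) (Ebasis v)"
    by (rule arg_cong[where f = "\<lambda>x. form V adj e x (Ebasis v)"]) (auto simp: EG_def)
  also have "\<dots> = of_int (e v + int (valency V adj v))"
    unfolding form_of_int_Ebasis[OF t v] using v by (simp add: pairing_def valency_def)
  finally show ?thesis .
qed

text \<open>Adjunction: \<open>ZK\<close> pairs to \<open>e v + 2\<close> and \<open>EG\<close> to
  \<open>e v\<close> plus the valency, so their difference contributes 2 minus the valency.\<close>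

lemma form_dual_point:
  assumes t: "decorated_tree V adj e" and v: "v \<in> V"
  shows "form V adj e (dual_point V adj e x) (Ebasis v) =
    - of_int (int (valency V adj v) - 2 + pairing V adj e x v)"
proof -
  have "dual_point V adj e x = (\<lambda>w. (\<lambda>w. ZK V adj e w + (-1) * EG V w) w + (-1) * of_int (x w))"
    by (auto simp: dual_point_def)
  then show ?thesis
    using ZK_props(2)[OF tree_finite[OF t] tree_negdef[OF t] v] form_EG_Ebasis[OF t v]
      form_of_int_Ebasis[OF t v]
    by (simp only: form_add_left) simp
qed

text \<open>The dual vectors are linearly independent, so at most one exponent vector contributes to
  the coefficient.\<close>

lemma zG_dual_point:
  assumes t: "decorated_tree V adj e" and x: "int_supported V x"
  shows "zG V adj e (dual_point V adj e x) = weight V adj e x"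
proof -
  have fin: "finite V" and nd: "negdef V adj e" using tree_finite[OF t] tree_negdef[OF t] .
  define k where "k v = int (valency V adj v) - 2 + pairing V adj e x v" for v
  let ?K = "{k :: 'a \<Rightarrow> nat. (\<forall>v. v \<notin> V \<longrightarrow> k v = 0) \<and>
        (\<lambda>w. \<Sum>v\<in>V. of_nat (k v) * Edual V adj e v w) = dual_point V adj e x}"
  have psup: "supported V (dual_point V adj e x)"
    using x ZK_props(1)[OF fin nd] by (auto simp: supported_def dual_point_def int_supported_def EG_def)
  have form_comb: "form V adj e (\<lambda>w. \<Sum>v\<in>V. of_nat (h v) * Edual V adj e v w) (Ebasis u) = - of_nat (h u)"
    if u: "u \<in> V" for h :: "'a \<Rightarrow> nat" and u
  proof -
    have "form V adj e (\<lambda>w. \<Sum>v\<in>V. of_nat (h v) * Edual V adj e v w) (Ebasis u) =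
        (\<Sum>w\<in>V. \<Sum>v\<in>V. of_nat (h v) * Edual V adj e v w * imat adj e w u)"
      by (simp add: form_Ebasis[OF fin u] sum_distrib_right)
    also have "\<dots> = (\<Sum>v\<in>V. of_nat (h v) * form V adj e (Edual V adj e v) (Ebasis u))"
      by (subst sum.swap) (simp add: form_Ebasis[OF fin u] sum_distrib_left mult.assoc)
    also have "\<dots> = (\<Sum>v\<in>V. if v = u then - of_nat (h u) else 0)"
      by (intro sum.cong refl) (simp add: Edual_props(2)[OF fin nd u])
    finally show ?thesis using u fin by simp
  qed
  \<comment> \<open>Pairing with \<open>Ebasis v\<close> reads off the multiplicity at
    \<open>v\<close>; nondegeneracy gives the converse.\<close>
  have K_iff: "h \<in> ?K \<longleftrightarrow> (\<forall>v. v \<notin> V \<longrightarrow> h v = 0) \<and> (\<forall>v\<in>V. int (h v) = k v)" (is "_ \<longleftrightarrow> ?R h") for h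
  proof
    assume h: "h \<in> ?K"
    have "int (h v) = k v" if v: "v \<in> V" for v
    proof -
      have "- of_nat (h v) = - (of_int (k v) :: rat)"
        using form_comb[OF v, of h] form_dual_point[OF t v, of x] h by (simp add: k_def)
      then have "of_int (int (h v)) = (of_int (k v) :: rat)" by simp
      then show ?thesis by (simp only: of_int_eq_iff)
    qed
    then show "?R h" using h by blast
  next
    assume h: "?R h"
    have "(\<lambda>w. \<Sum>v\<in>V. of_nat (h v) * Edual V adj e v w) = dual_point V adj e x"
    proof (rule negdef_nondegenerate[OF fin nd _ psup])
      show "supported V (\<lambda>w. \<Sum>v\<in>V. of_nat (h v) * Edual V adj e v w)"
        using Edual_props(1)[OF fin nd] by (auto simp: supported_def)
      fix u assume u: "u \<in> V"
      have "of_nat (h u) = (of_int (k u) :: rat)" using h u by (metis of_int_of_nat_eq)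
      then show "form V adj e (\<lambda>w. \<Sum>v\<in>V. of_nat (h v) * Edual V adj e v w) (Ebasis u)
          = form V adj e (dual_point V adj e x) (Ebasis u)"
        unfolding form_comb[OF u] form_dual_point[OF t u] k_def by simp
    qed
    then show "h \<in> ?K" using h by blast
  qed
  show ?thesis
  \<comment> \<open>The index set is a singleton if all multiplicities are nonnegative. Otherwise it
    is empty, and some factor \<open>zc\<close> vanishes as well.\<close>
  proof (cases "\<forall>v\<in>V. k v \<ge> 0")
    case True
    define h where "h v = (if v \<in> V then nat (k v) else 0)" for v
    have "?K = {h}"
    proof (intro set_eqI)
      fix g show "g \<in> ?K \<longleftrightarrow> g \<in> {h}"
        unfolding K_iff using True by (fastforce simp: h_def fun_eq_iff)
    qed
    then have "zG V adj e (dual_point V adj e x) = (\<Prod>v\<in>V. zcoef (int (valency V adj v) - 2) (h v))"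
      unfolding zG_def by simp
    also have "\<dots> = weight V adj e x"
      unfolding weight_def vertex_factor_def using True
      by (intro prod.cong refl) (auto simp: h_def zc_def k_def)
    finally show ?thesis .
  next
    case False
    then obtain v where v: "v \<in> V" "k v < 0" by force
    have "g \<notin> ?K" for g unfolding K_iff using v by force
    then have "?K = {}" by blast
    then have "zG V adj e (dual_point V adj e x) = 0" unfolding zG_def by (simp only: sum.empty)
    moreover have "weight V adj e x = 0"
      unfolding weight_def vertex_factor_def using v fin by (auto simp: zc_def k_def)
    ultimately show ?thesis by simp
  qed
qed

lemma dual_point_inj: "dual_point V adj e x = dual_point V adj e y \<longleftrightarrow> x = y"
  by (auto simp: dual_point_def fun_eq_iff)

lemma piC_dual_point:
  "piC V V' adj e (dual_point V' adj e x) = dual_point V adj e (int_restr V x)"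
  by (auto simp: piC_def dual_point_def restr_def int_restr_def fun_eq_iff)

lemma suppP0_eq:
  assumes t: "decorated_tree V adj e"
  shows "suppP0 V adj e = dual_point V adj e `
    {x. int_supported V x \<and> (\<exists>v\<in>V. x v \<ge> 0) \<and> weight V adj e x \<noteq> 0}" (is "_ = ?f ` ?X")
proof (intro set_eqI iffI)
  fix p assume "p \<in> suppP0 V adj e"
  then obtain y where y: "p = ZK V adj e - EG V - y" "y \<in> latL V" "\<not> (\<forall>v\<in>V. y v < 0)" "zG V adj e p \<noteq> 0"
    unfolding suppP0_def by blast
  define x where "x v = \<lfloor>y v\<rfloor>" for v
  have yx: "y v = of_int (x v)" for v
    using y(2) unfolding latL_def supported_def x_def by (cases "v \<in> V") (auto elim: Ints_cases)
  then have yx': "y = (\<lambda>v. of_int (x v))" by blast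
  have p: "p = ?f x" using y(1) unfolding dual_point_def yx' .
  have "int_supported V x" using y(2) by (auto simp: latL_def supported_def x_def int_supported_def)
  moreover have "\<exists>v\<in>V. x v \<ge> 0" using y(3) by (auto simp: yx not_less)
  ultimately have "x \<in> ?X" using y(4) zG_dual_point[OF t] p by auto
  then show "p \<in> ?f ` ?X" using p by blast
next
  fix p assume "p \<in> ?f ` ?X"
  then obtain x where x: "x \<in> ?X" "p = ?f x" by blast
  have "(\<lambda>v. of_int (x v)) \<in> latL V" "\<not> (\<forall>v\<in>V. (of_int (x v) :: rat) < 0)"
    using x by (auto simp: latL_def int_supported_def supported_def not_less)
  moreover have "zG V adj e (ZK V adj e - EG V - (\<lambda>v. of_int (x v))) \<noteq> 0"
    using x zG_dual_point[OF t] by (auto simp: dual_point_def)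
  ultimately show "p \<in> suppP0 V adj e"
    unfolding suppP0_def x(2) dual_point_def by blast
qed

text \<open>A nonnegative coordinate of \<open>x\<close> on \<open>V\<close> is also one of every
  \<open>y\<close> restricting to \<open>x\<close>, so this condition of \<open>suppP0\<close> holds
  automatically on the fibre.\<close>

lemma piC_inv_dual_point:
  assumes t: "decorated_tree V' adj e" and "V \<subseteq> V'" and "\<exists>v\<in>V. x v \<ge> 0"
  shows "piC_inv V V' adj e (dual_point V adj e x) = dual_point V' adj e `
    {y. int_supported V' y \<and> int_restr V y = x \<and> weight V' adj e y \<noteq> 0}"
proof -
  have "\<exists>v\<in>V'. y v \<ge> 0" if "int_restr V y = x" for y
  proof -
    obtain v where v: "v \<in> V" "x v \<ge> 0" using assms(3) by blast
    then have "y v \<ge> 0" using that by (auto simp: int_restr_def)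
    then show ?thesis using v assms(2) by blast
  qed
  then show ?thesis
    unfolding piC_inv_def suppP0_eq[OF t] by (auto simp: piC_dual_point dual_point_inj)
qed

section \<open>Counting points in boxes\<close>

lemma zc_nonneg: "zc n k \<noteq> 0 \<Longrightarrow> k \<ge> 0"
  by (auto simp: zc_def split: if_splits)

lemma zc_0: "zc n 0 = 1"
  by (simp add: zc_def zcoef_def)

text \<open>Partial sums of coefficients correspond to multiplication by
  \<open>1 / (1 - t)\<close>.\<close>

lemma sum_zc: "(\<Sum>i\<in>{0..N}. zc n i) = zc (n - 1) N"
proof (cases "N < 0")
  case True
  then show ?thesis by (simp add: zc_def)
next
  case False
  then obtain m where m: "N = int m" by (metis nonneg_int_cases not_less)
  have "(\<Sum>i\<in>{0..N}. zc n i) = (\<Sum>i\<in>int ` {0..m}. zc n i)" by (simp add: m image_int_atLeastAtMost)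
  also have "\<dots> = (\<Sum>k\<le>m. zcoef n k)"
    by (subst sum.reindex) (auto simp: zc_def atMost_atLeast0)
  also have "\<dots> = zcoef (n - 1) m"
    using gbinomial_sum_lower_neg[of "of_int n :: rat" m] by (simp add: zcoef_def mult.commute)
  finally show ?thesis by (simp add: m zc_def)
qed

text \<open>The geometric series, which is the local factor of an end-vertex.\<close>

lemma zc_minus_one: "zc (-1) k = (if k < 0 then 0 else 1)"
proof -
  have "zcoef (-1) m = 1" for m
  proof -
    have "(of_nat m :: rat) gchoose m = 1"
      using binomial_gbinomial[of m m, where 'a = rat] by simp
    moreover have "(- 1 :: rat) gchoose m = (- 1) ^ m * (of_nat m gchoose m)"
      using gbinomial_minus[of "1::rat" m] by simp
    moreover have "(- 1 :: rat) ^ m * (- 1) ^ m = 1" by (simp flip: power_mult_distrib)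
    ultimately show ?thesis by (simp add: zcoef_def)
  qed
  then show ?thesis by (simp add: zc_def)
qed

lemma zc_zero_exponent: "k \<noteq> 0 \<Longrightarrow> zc 0 k = 0"
  by (auto simp: zc_def zcoef_def gbinomial_0_left)

text \<open>Here \<open>z\<close> prescribes the values off \<open>W\<close>. The lower bound on the
  total, together with the upper bounds \<open>A\<close>, makes the set finite for finite
  \<open>W\<close>.\<close>

definition box :: "'a set \<Rightarrow> ('a \<Rightarrow> int) \<Rightarrow> ('a \<Rightarrow> int) \<Rightarrow> int \<Rightarrow> ('a \<Rightarrow> int) set" where
  "box W z A T = {x. (\<forall>v. v \<notin> W \<longrightarrow> x v = z v) \<and> (\<forall>w\<in>W. x w \<le> A w) \<and> T + (\<Sum>w\<in>W. x w) \<ge> 0}"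

text \<open>With the other coordinates at most \<open>A\<close>, the condition on the total bounds
  the coordinate at \<open>w\<close> from below.\<close>

lemma box_insert:
  assumes "finite W" "w \<notin> W"
  shows "box (insert w W) z A T = (\<Union>a\<in>{- (T + (\<Sum>v\<in>W. A v))..A w}. box W (z(w := a)) A (T + a))"
proof (intro set_eqI iffI)
  fix x assume x: "x \<in> box (insert w W) z A T"
  have "(\<Sum>v\<in>W. x v) \<le> (\<Sum>v\<in>W. A v)" using x by (intro sum_mono) (auto simp: box_def)
  then have "x w \<in> {- (T + (\<Sum>v\<in>W. A v))..A w}" "x \<in> box W (z(w := x w)) A (T + x w)"
    using x assms by (auto simp: box_def)
  then show "x \<in> (\<Union>a\<in>{- (T + (\<Sum>v\<in>W. A v))..A w}. box W (z(w := a)) A (T + a))" by blast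
next
  fix x assume "x \<in> (\<Union>a\<in>{- (T + (\<Sum>v\<in>W. A v))..A w}. box W (z(w := a)) A (T + a))"
  then obtain a where a: "a \<le> A w" "x \<in> box W (z(w := a)) A (T + a)" by auto
  then have "x w = a" using assms by (auto simp: box_def)
  then show "x \<in> box (insert w W) z A T" using a assms by (auto simp: box_def)
qed

text \<open>In terms of generating functions: \<open>(1 - t)\<^sup>n\<close> times one factor \<open>1 / (1 - t)\<close> per element of \<open>W\<close>.\<close>
lemma box_sum:
  assumes "finite W"
  shows "finite (box W z A T) \<and>
    (\<Sum>x\<in>box W z A T. zc n (T + (\<Sum>w\<in>W. x w))) = zc (n - int (card W)) (T + (\<Sum>w\<in>W. A w))"
  using assms
proof (induction W arbitrary: z T rule: finite_induct)
  case empty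
  have "box {} z A T = (if T \<ge> 0 then {z} else {})" by (auto simp: box_def fun_eq_iff)
  then show ?case by (simp add: zc_def)
next
  case (insert w W)
  let ?I = "{- (T + (\<Sum>v\<in>W. A v))..A w}"
  let ?B = "\<lambda>a. box W (z(w := a)) A (T + a)"
  have val: "x w = a" if "x \<in> ?B a" for x a using that insert by (auto simp: box_def)
  have disj: "\<forall>a\<in>?I. \<forall>b\<in>?I. a \<noteq> b \<longrightarrow> ?B a \<inter> ?B b = {}" using val by blast
  have fin: "finite (?B a)" for a using insert.IH by blast
  have "(\<Sum>x\<in>box (insert w W) z A T. zc n (T + (\<Sum>v\<in>insert w W. x v))) =
      (\<Sum>a\<in>?I. \<Sum>x\<in>?B a. zc n (T + (\<Sum>v\<in>insert w W. x v)))"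
    unfolding box_insert[OF insert.hyps] by (rule sum.UNION_disjoint) (use fin disj in auto)
  also have "\<dots> = (\<Sum>a\<in>?I. \<Sum>x\<in>?B a. zc n ((T + a) + (\<Sum>v\<in>W. x v)))"
    using insert.hyps val by (intro sum.cong refl) (auto simp: add.assoc)
  also have "\<dots> = (\<Sum>a\<in>?I. zc (n - int (card W)) (T + a + (\<Sum>v\<in>W. A v)))"
    using insert.IH by (intro sum.cong refl) blast
  \<comment> \<open>The shift sends the least admissible \<open>a\<close> to 0, so the slices add up
    to a partial sum of coefficients.\<close>
  also have "\<dots> = (\<Sum>i\<in>{0..T + A w + (\<Sum>v\<in>W. A v)}. zc (n - int (card W)) i)"
    by (rule sum.reindex_bij_witness[of _ "\<lambda>i. i - (T + (\<Sum>v\<in>W. A v))" "\<lambda>a. T + a + (\<Sum>v\<in>W. A v)"]) auto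
  also have "\<dots> = zc (n - int (card W) - 1) (T + A w + (\<Sum>v\<in>W. A v))" by (rule sum_zc)
  finally show ?case
    using insert.hyps fin by (simp add: box_insert algebra_simps)
qed

section \<open>Gluing vertices to an end\<close>

lemma pairing_cong: "v \<in> V \<Longrightarrow> (\<And>w. w \<in> V \<Longrightarrow> x w = y w) \<Longrightarrow> pairing V adj e x v = pairing V adj e y v"
  unfolding pairing_def by (auto intro!: sum.cong)

lemma weight_cong: "(\<And>w. w \<in> V \<Longrightarrow> x w = y w) \<Longrightarrow> weight V adj e x = weight V adj e y"
  unfolding weight_def vertex_factor_def using pairing_cong[of _ V x y adj e] by (auto intro!: prod.cong)

text \<open>The coordinate form of \<open>piC_inv\<close>, for \<open>x\<close> with a nonnegative
  coordinate on \<open>V\<close>.\<close>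

definition fibre :: "'a set \<Rightarrow> 'a set \<Rightarrow> ('a \<Rightarrow> 'a \<Rightarrow> bool) \<Rightarrow> ('a \<Rightarrow> int) \<Rightarrow> ('a \<Rightarrow> int) \<Rightarrow> ('a \<Rightarrow> int) set" where
  "fibre V V' adj e x = {y. int_supported V' y \<and> int_restr V y = x \<and> weight V' adj e y \<noteq> 0}"

lemma int_le_div_iff:
  assumes "(d::int) > 0"
  shows "a \<le> c div d \<longleftrightarrow> a * d \<le> c"
proof
  assume "a \<le> c div d"
  then have "a * d \<le> (c div d) * d" using assms by (intro mult_right_mono) auto
  also have "\<dots> \<le> c" using assms pos_mod_sign[of d c] div_mult_mod_eq[of c d] by linarith
  finally show "a * d \<le> c" .
next
  assume "a * d \<le> c"
  then show "a \<le> c div d" using zdiv_mono1[of "a * d" c d] assms by simp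
qed

text \<open>One gluing step with its end \<open>u\<close> fixed. Negative decorations on the new
  vertices turn their local factors into upper bounds.\<close>

locale end_glued =
  fixes V V' :: "'a set" and adj :: "'a \<Rightarrow> 'a \<Rightarrow> bool" and e :: "'a \<Rightarrow> int" and u :: 'a
  assumes tree: "decorated_tree V' adj e"
    and sub: "V \<subset> V'"
    and u: "u \<in> V" "valency V adj u = 1"
    and glued: "\<And>w x. w \<in> V' - V \<Longrightarrow> x \<in> V' \<Longrightarrow> adj w x \<longleftrightarrow> x = u"
    and e_neg: "\<And>w. w \<in> V' - V \<Longrightarrow> e w < 0"
begin

definition s :: int where "s = int (card (V' - V))"

text \<open>The largest value at a new vertex \<open>w\<close> for which the exponent
  \<open>e w * a + x u - 1\<close> at \<open>w\<close> is nonnegative.\<close>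

definition bound :: "('a \<Rightarrow> int) \<Rightarrow> 'a \<Rightarrow> int" where
  "bound x w = (x u - 1) div (- e w)"

lemma fin: "finite V'" "finite V" "finite (V' - V)"
  using tree_finite[OF tree] sub by (auto intro: finite_subset)

lemma s_pos: "s \<ge> 1"
  using sub fin by (simp add: s_def Suc_le_eq card_gt_0_iff)

lemma nbrs_old: "v \<in> V - {u} \<Longrightarrow> {w. w \<in> V' \<and> adj v w} = {w. w \<in> V \<and> adj v w}"
  using sub glued tree_sym[OF tree] by blast

lemma nbrs_u: "{w. w \<in> V' \<and> adj u w} = {w. w \<in> V \<and> adj u w} \<union> (V' - V)"
  using sub u glued tree_sym[OF tree] by auto

lemma nbrs_new: "w \<in> V' - V \<Longrightarrow> {x. x \<in> V' \<and> adj w x} = {u}"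
  using sub u glued by auto

lemma pairing_old: "v \<in> V - {u} \<Longrightarrow> pairing V' adj e x v = pairing V adj e x v"
  by (simp add: pairing_def nbrs_old)

lemma pairing_u: "pairing V' adj e x u = pairing V adj e x u + (\<Sum>w\<in>V' - V. x w)"
  unfolding pairing_def nbrs_u using fin by (subst sum.union_disjoint) auto

lemma pairing_new: "w \<in> V' - V \<Longrightarrow> pairing V' adj e x w = e w * x w + x u"
  by (simp add: pairing_def nbrs_new)

lemma valency_old: "v \<in> V - {u} \<Longrightarrow> valency V' adj v = valency V adj v"
  by (simp add: valency_def nbrs_old)

lemma valency_u: "int (valency V' adj u) = 1 + s"
proof -
  have "card ({w. w \<in> V \<and> adj u w} \<union> (V' - V)) = card {w. w \<in> V \<and> adj u w} + card (V' - V)"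
    using fin by (intro card_Un_disjoint) auto
  then show ?thesis using u(2) unfolding valency_def nbrs_u s_def by simp
qed

lemma valency_new: "w \<in> V' - V \<Longrightarrow> valency V' adj w = 1"
  by (simp add: valency_def nbrs_new)

lemma le_bound_iff: "w \<in> V' - V \<Longrightarrow> a \<le> bound x w \<longleftrightarrow> e w * a + x u \<ge> 1"
proof -
  assume w: "w \<in> V' - V"
  have "a \<le> bound x w \<longleftrightarrow> a * (- e w) \<le> x u - 1"
    unfolding bound_def using e_neg[OF w] by (intro int_le_div_iff) simp
  then show ?thesis by (auto simp: algebra_simps)
qed

text \<open>The valency of \<open>u\<close> rises from 1 to \<open>1 + s\<close>, so its series
  \<open>1 / (1 - t)\<close> becomes \<open>(1 - t)^(s - 1)\<close>. Each new vertex is an end, with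
  factor 1 or 0 according to \<open>bound\<close>.\<close>

lemma weight_glued:
  assumes "weight V adj e x \<noteq> 0"
  shows "weight V' adj e x = (if \<forall>w\<in>V' - V. x w \<le> bound x w
    then weight V adj e x * zc (s - 1) (s - 1 + pairing V adj e x u + (\<Sum>w\<in>V' - V. x w)) else 0)"
proof -
  let ?R = "\<Prod>v\<in>V - {u}. vertex_factor V adj e x v"
  have "weight V adj e x = vertex_factor V adj e x u * ?R"
    unfolding weight_def by (rule prod.remove[OF fin(2) u(1)])
  \<comment> \<open>As a coefficient of the geometric series this factor is 0 or 1, and a nonzero
    weight excludes 0.\<close>
  moreover from this have "vertex_factor V adj e x u = 1"
    using assms u(2) by (auto simp: vertex_factor_def zc_minus_one split: if_splits)
  ultimately have R: "weight V adj e x = ?R" by simp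
  have V': "insert u (V - {u}) \<union> (V' - V) = V'" using u sub by blast
  have "prod g (insert u (V - {u}) \<union> (V' - V)) = prod g (insert u (V - {u})) * prod g (V' - V)" for g :: "'a \<Rightarrow> rat"
    using fin u by (intro prod.union_disjoint) auto
  then have split: "prod g V' = g u * prod g (V - {u}) * prod g (V' - V)" for g :: "'a \<Rightarrow> rat"
    unfolding V' using prod.insert[of "V - {u}" u g] fin by simp
  have "weight V' adj e x = vertex_factor V' adj e x u * (\<Prod>v\<in>V - {u}. vertex_factor V' adj e x v) *
      (\<Prod>w\<in>V' - V. vertex_factor V' adj e x w)"
    unfolding weight_def by (rule split)
  moreover have "(\<Prod>v\<in>V - {u}. vertex_factor V' adj e x v) = ?R"
    by (intro prod.cong refl) (simp add: vertex_factor_def pairing_old valency_old)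
  moreover have "vertex_factor V' adj e x u = zc (s - 1) (s - 1 + pairing V adj e x u + (\<Sum>w\<in>V' - V. x w))"
    by (simp add: vertex_factor_def valency_u pairing_u algebra_simps)
  moreover have "(\<Prod>w\<in>V' - V. vertex_factor V' adj e x w) = (\<Prod>w\<in>V' - V. if x w \<le> bound x w then 1 else 0)"
    by (intro prod.cong refl)
      (auto simp: vertex_factor_def pairing_new valency_new zc_minus_one le_bound_iff)
  moreover have "\<dots> = (if \<forall>w\<in>V' - V. x w \<le> bound x w then 1 else 0)"
    using fin by auto
  ultimately show ?thesis using R by simp
qed

lemma vertex_factor_newD:
  "vertex_factor V' adj e x w \<noteq> 0 \<Longrightarrow> w \<in> V' - V \<Longrightarrow> x w \<le> bound x w"
  by (auto simp: vertex_factor_def pairing_new valency_new zc_minus_one le_bound_iff split: if_splits)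

lemma vertex_factor_uD:
  assumes "vertex_factor V' adj e x u \<noteq> 0"
  shows "s - 1 + pairing V adj e x u + (\<Sum>w\<in>V' - V. x w) \<ge> 0"
  using zc_nonneg[OF assms[unfolded vertex_factor_def]] by (simp add: valency_u pairing_u)

lemma weight_nonzeroD: "weight V' adj e x \<noteq> 0 \<Longrightarrow> v \<in> V' \<Longrightarrow> vertex_factor V' adj e x v \<noteq> 0"
  using fin by (auto simp: weight_def)

text \<open>Gluing affects only the factor at \<open>u\<close>. This yields local constraints on
  \<open>V\<close> even when the weight on \<open>V\<close> itself may vanish.\<close>

lemma vertex_factor_below:
  assumes "weight V' adj e x \<noteq> 0" "v \<in> V - {u}"
  shows "vertex_factor V adj e x v \<noteq> 0"
proof -
  have "vertex_factor V' adj e x v \<noteq> 0" using assms fin sub by (auto simp: weight_def)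
  then show ?thesis using assms by (simp add: vertex_factor_def pairing_old valency_old)
qed

lemma weight_fibre_eq:
  assumes "weight V adj e x \<noteq> 0" "\<And>v. v \<in> V \<Longrightarrow> y v = x v"
  shows "weight V' adj e y = (if \<forall>w\<in>V' - V. y w \<le> bound x w
    then weight V adj e x * zc (s - 1) (s - 1 + pairing V adj e x u + (\<Sum>w\<in>V' - V. y w)) else 0)"
proof -
  have "weight V adj e y = weight V adj e x" "pairing V adj e y u = pairing V adj e x u"
    using assms u by (auto intro: weight_cong pairing_cong)
  moreover have "bound y = bound x" using assms u by (auto simp: bound_def)
  ultimately show ?thesis using weight_glued[of y] assms(1) by simp
qed

lemma fibreD:
  assumes "y \<in> fibre V V' adj e x"
  shows "int_supported V' y" "v \<in> V \<Longrightarrow> y v = x v" "weight V' adj e y \<noteq> 0" "int_supported V x"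
  using assms by (auto simp: fibre_def int_restr_def int_supported_def)

lemma fibreI:
  assumes "int_supported V' y" "\<And>v. v \<in> V \<Longrightarrow> y v = x v" "weight V' adj e y \<noteq> 0" "int_supported V x"
  shows "y \<in> fibre V V' adj e x"
  using assms by (auto simp: fibre_def int_restr_def int_supported_def fun_eq_iff)

section \<open>Finiteness, nonemptiness and slice sums of the fibres\<close>

lemma finite_fibre:
  assumes "weight V adj e x \<noteq> 0"
  shows "finite (fibre V V' adj e x)"
proof (rule finite_subset)
  show "finite (box (V' - V) x (bound x) (s - 1 + pairing V adj e x u))"
    using box_sum fin by blast
  show "fibre V V' adj e x \<subseteq> box (V' - V) x (bound x) (s - 1 + pairing V adj e x u)"
  proof
    fix y assume y: "y \<in> fibre V V' adj e x"
    have "y v = x v" if "v \<notin> V' - V" for v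
      using fibreD[OF y] that by (cases "v \<in> V") (auto simp: int_supported_def)
    then show "y \<in> box (V' - V) x (bound x) (s - 1 + pairing V adj e x u)"
      using fibreD(3)[OF y] weight_fibre_eq[OF assms fibreD(2)[OF y]] zc_nonneg
      by (auto simp: box_def split: if_splits)
  qed
qed

text \<open>The new coordinates can be lowered freely below their bounds, so only the largest
  possible exponent at \<open>u\<close> matters.\<close>

lemma fibre_nonempty_iff:
  assumes "weight V adj e x \<noteq> 0" and x: "int_supported V x"
  shows "fibre V V' adj e x \<noteq> {} \<longleftrightarrow> s - 1 + pairing V adj e x u + (\<Sum>w\<in>V' - V. bound x w) \<ge> 0"
    (is "_ \<longleftrightarrow> ?N \<ge> 0")
proof
  assume "fibre V V' adj e x \<noteq> {}"
  then obtain y where y: "y \<in> fibre V V' adj e x" by blast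
  then have "\<forall>w\<in>V' - V. y w \<le> bound x w" "s - 1 + pairing V adj e x u + (\<Sum>w\<in>V' - V. y w) \<ge> 0"
    using fibreD(3)[OF y] weight_fibre_eq[OF assms(1) fibreD(2)[OF y]] zc_nonneg
    by (auto split: if_splits)
  then show "?N \<ge> 0" using sum_mono[of "V' - V" y "bound x"] by force
next
  assume N: "?N \<ge> 0"
  obtain w0 where w0: "w0 \<in> V' - V" using sub by blast
  \<comment> \<open>The whole excess \<open>?N\<close> is removed at one new vertex. The exponent at
    \<open>u\<close> becomes 0, where the coefficient is 1; at other exponents it could
    vanish.\<close>
  define y where "y v = (if v \<in> V' - V then bound x v - (if v = w0 then ?N else 0) else x v)" for v
  have "(\<Sum>w\<in>V' - V. y w) = (\<Sum>w\<in>V' - V. bound x w) - ?N"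
    using w0 fin by (simp add: y_def sum_subtractf)
  then have "s - 1 + pairing V adj e x u + (\<Sum>w\<in>V' - V. y w) = 0" by simp
  moreover have "\<forall>w\<in>V' - V. y w \<le> bound x w" using N by (auto simp: y_def)
  moreover have yx: "\<And>v. v \<in> V \<Longrightarrow> y v = x v" by (auto simp: y_def)
  ultimately have "weight V' adj e y \<noteq> 0"
    using weight_fibre_eq[OF assms(1), of y] assms(1) by (simp add: zc_0)
  moreover have "int_supported V' y" using x sub by (auto simp: int_supported_def y_def)
  ultimately show "fibre V V' adj e x \<noteq> {}" using fibreI x yx by blast
qed

text \<open>Fixing one new coordinate leaves \<open>s - 1\<close> free ones. Each contributes
  \<open>1 / (1 - t)\<close>, which cancels \<open>(1 - t)^(s - 1)\<close> and leaves the constant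
  series 1.\<close>

lemma fibre_slice_sum:
  assumes nz: "weight V adj e x \<noteq> 0" and w: "w \<in> V' - V" and x: "int_supported V x"
    and a: "s - 1 + pairing V adj e x u + a + (\<Sum>v\<in>V' - V - {w}. bound x v) \<noteq> 0"
  shows "(\<Sum>y | y \<in> fibre V V' adj e x \<and> y w = a. weight V' adj e y) = 0"
proof (cases "a \<le> bound x w")
  case False
  then have "y w \<noteq> a" if "y \<in> fibre V V' adj e x" for y
    using w fibreD(3)[OF that] weight_fibre_eq[OF nz fibreD(2)[OF that]] by (auto split: if_splits)
  then have "{y. y \<in> fibre V V' adj e x \<and> y w = a} = {}" by blast
  then show ?thesis by (simp only: sum.empty)
next
  case True
  let ?T = "s - 1 + pairing V adj e x u"
  let ?W = "V' - V - {w}"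
  let ?B = "box ?W (x(w := a)) (bound x) (?T + a)"
  have finW: "finite ?W" using fin by blast
  have card: "int (card ?W) = s - 1"
    using w fin s_pos by (simp add: s_def card_Diff_singleton)
  have split: "(\<Sum>v\<in>V' - V. y v) = y w + (\<Sum>v\<in>?W. y v)" for y :: "'a \<Rightarrow> int"
    by (rule sum.remove[OF fin(3) w])
  have in_B: "weight V' adj e y = weight V adj e x * zc (s - 1) (?T + a + (\<Sum>v\<in>?W. y v))"
    "int_supported V' y" "\<And>v. v \<in> V \<Longrightarrow> y v = x v" "y w = a" if y: "y \<in> ?B" for y
  proof -
    show yx: "\<And>v. v \<in> V \<Longrightarrow> y v = x v" and yw: "y w = a" using y w by (auto simp: box_def)
    show "int_supported V' y" using y w x sub by (auto simp: box_def int_supported_def)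
    have "\<forall>v\<in>V' - V. y v \<le> bound x v" using y True yw by (auto simp: box_def)
    then show "weight V' adj e y = weight V adj e x * zc (s - 1) (?T + a + (\<Sum>v\<in>?W. y v))"
      using weight_fibre_eq[OF nz yx] split[of y] yw by (simp add: add.assoc)
  qed
  \<comment> \<open>The box also contains points of weight zero, which do not change the
    sum.\<close>
  have "(\<Sum>y | y \<in> fibre V V' adj e x \<and> y w = a. weight V' adj e y) = (\<Sum>y\<in>?B. weight V' adj e y)"
  proof (rule sum.mono_neutral_left)
    show "finite ?B" by (rule conjunct1[OF box_sum[OF finW]])
    show "{y. y \<in> fibre V V' adj e x \<and> y w = a} \<subseteq> ?B"
    proof
      fix y assume "y \<in> {y. y \<in> fibre V V' adj e x \<and> y w = a}"
      then have y: "y \<in> fibre V V' adj e x" and yw: "y w = a" by auto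
      note f = weight_fibre_eq[OF nz fibreD(2)[OF y]] fibreD(3)[OF y]
      have le: "\<forall>v\<in>V' - V. y v \<le> bound x v" using f by (simp split: if_splits)
      have "zc (s - 1) (?T + (\<Sum>v\<in>V' - V. y v)) \<noteq> 0" using f le by simp
      then have "?T + a + (\<Sum>v\<in>?W. y v) \<ge> 0" using zc_nonneg[of "s - 1" "?T + (\<Sum>v\<in>V' - V. y v)"] split[of y] yw by linarith
      moreover have "y v = (x(w := a)) v" if v: "v \<notin> ?W" for v
      proof (cases "v = w")
        case False
        then consider "v \<in> V" | "v \<notin> V" "v \<notin> V'" using v by blast
        then show ?thesis
          using False fibreD(1,4)[OF y] fibreD(2)[OF y, of v] by cases (simp_all add: int_supported_def)
      qed (simp add: yw)
      ultimately show "y \<in> ?B" using le unfolding box_def by blast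
    qed
    show "\<forall>y\<in>?B - {y. y \<in> fibre V V' adj e x \<and> y w = a}. weight V' adj e y = 0"
    proof
      fix y assume y: "y \<in> ?B - {y. y \<in> fibre V V' adj e x \<and> y w = a}"
      then have "y \<notin> fibre V V' adj e x" using in_B(4)[of y] by simp
      then show "weight V' adj e y = 0" using fibreI[OF in_B(2,3)[of y] _ x] y by blast
    qed
  qed
  also have "\<dots> = weight V adj e x * (\<Sum>y\<in>?B. zc (s - 1) (?T + a + (\<Sum>v\<in>?W. y v)))"
    by (simp add: sum_distrib_left in_B(1))
  also have "\<dots> = weight V adj e x * zc 0 (?T + a + (\<Sum>v\<in>?W. bound x v))"
    using box_sum[OF finW, of "x(w := a)" "bound x" "?T + a" "s - 1"] card by simp
  also have "\<dots> = 0" using zc_zero_exponent[OF a] by simp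
  finally show ?thesis .
qed

end

section \<open>Elliptic cycles\<close>

lemma form_sym:
  assumes "decorated_tree V adj e"
  shows "form V adj e x y = form V adj e y x"
proof -
  have "form V adj e x y = (\<Sum>w\<in>V. \<Sum>v\<in>V. x v * y w * imat adj e v w)"
    unfolding form_def by (rule sum.swap)
  also have "\<dots> = form V adj e y x"
    unfolding form_def using tree_sym[OF assms] by (intro sum.cong refl) (auto simp: imat_def)
  finally show ?thesis .
qed

text \<open>Adjunction eliminates \<open>ZK\<close>, which depends on the whole graph, so that
  values on a graph and on a subgraph become comparable.\<close>

lemma chi_expand:
  assumes t: "decorated_tree V adj e"
  shows "chi V adj e x = ((\<Sum>w\<in>V. x w * (of_int (e w) + 2)) - form V adj e x x) / 2"
proof -
  have fin: "finite V" and nd: "negdef V adj e" using tree_finite[OF t] tree_negdef[OF t] .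
  have "form V adj e (ZK V adj e) x = (\<Sum>w\<in>V. x w * (of_int (e w) + 2))"
    unfolding form_expand_right[OF fin, of _ _ _ x] using ZK_props(2)[OF fin nd] by (intro sum.cong refl) simp
  moreover have "x - ZK V adj e = (\<lambda>v. x v + (-1) * ZK V adj e v)" by auto
  then have "form V adj e (x - ZK V adj e) x = form V adj e x x - form V adj e (ZK V adj e) x"
    using form_add_left[of V adj e x "-1" "ZK V adj e" x] by simp
  then have "form V adj e x (x - ZK V adj e) = form V adj e x x - form V adj e (ZK V adj e) x"
    using form_sym[OF t, of x "x - ZK V adj e"] by simp
  ultimately show ?thesis by (simp add: chi_def)
qed

definition int_chi :: "'a set \<Rightarrow> ('a \<Rightarrow> 'a \<Rightarrow> bool) \<Rightarrow> ('a \<Rightarrow> int) \<Rightarrow> ('a \<Rightarrow> int) \<Rightarrow> rat" where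
  "int_chi V adj e x = chi V adj e (\<lambda>v. of_int (x v))"

text \<open>The identity \<chi>(x + E) = \<chi>(x) + \<chi>(E) - (x, E) for a basis vector E, where
  genus zero gives \<chi>(E) = 1.\<close>

lemma int_chi_increment:
  assumes t: "decorated_tree V adj e" and v: "v \<in> V"
  shows "int_chi V adj e (x(v := x v + 1)) = int_chi V adj e x + 1 - of_int (pairing V adj e x v)"
proof -
  have fin: "finite V" using tree_finite[OF t] .
  let ?x = "\<lambda>w. of_int (x w) :: rat"
  let ?y = "\<lambda>w. ?x w + 1 * Ebasis v w"
  have y: "(\<lambda>w. of_int ((x(v := x v + 1)) w)) = ?y" by (auto simp: Ebasis_def)
  have EE: "form V adj e (Ebasis v) (Ebasis v) = of_int (e v)"
  proof -
    have "form V adj e (Ebasis v) (Ebasis v) = (\<Sum>w\<in>V. if w = v then of_int (e v) else 0)"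
      unfolding form_Ebasis[OF fin v] by (intro sum.cong refl) (auto simp: Ebasis_def imat_def)
    then show ?thesis using v fin by simp
  qed
  have add: "form V adj e ?y z = form V adj e ?x z + form V adj e (Ebasis v) z" for z
    using form_add_left[of V adj e ?x 1 "Ebasis v" z] by simp
  have "form V adj e ?y ?y = form V adj e ?y ?x + form V adj e ?y (Ebasis v)"
    by (simp only: add form_sym[OF t, of ?x ?y] form_sym[OF t, of "Ebasis v" ?y])
  also have "\<dots> = form V adj e ?x ?x + 2 * form V adj e ?x (Ebasis v) + of_int (e v)"
    unfolding add EE form_sym[OF t, of "Ebasis v" ?x] by simp
  finally have q: "form V adj e ?y ?y = form V adj e ?x ?x + 2 * of_int (pairing V adj e x v) + of_int (e v)"
    by (simp add: form_of_int_Ebasis[OF t v])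
  have "(\<Sum>w\<in>V. ?y w * (of_int (e w) + 2)) =
      (\<Sum>w\<in>V. ?x w * (of_int (e w) + 2) + (if w = v then of_int (e v) + 2 else 0))"
    by (intro sum.cong refl) (auto simp: Ebasis_def algebra_simps)
  also have "\<dots> = (\<Sum>w\<in>V. ?x w * (of_int (e w) + 2)) + (of_int (e v) + 2)"
    using v fin by (simp add: sum.distrib)
  finally show ?thesis
    unfolding int_chi_def y chi_expand[OF t] q by (simp add: field_simps)
qed

lemma int_chi_mono_set:
  assumes "decorated_tree V adj e" "decorated_tree V' adj e" "V \<subseteq> V'" "int_supported V x"
  shows "int_chi V' adj e x = int_chi V adj e x"
proof -
  have "(\<Sum>w\<in>V'. of_int (x w) * (of_int (e w) + 2)) = (\<Sum>w\<in>V. of_int (x w) * (of_int (e w) + 2 :: rat))"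
    using assms tree_finite by (intro sum.mono_neutral_right) (auto simp: int_supported_def)
  moreover have "supported V (\<lambda>v. of_int (x v))" using assms by (auto simp: supported_def int_supported_def)
  ultimately show ?thesis
    using assms form_mono_set[OF tree_finite] by (simp add: int_chi_def chi_expand)
qed

lemma elliptic_int_chi_nonneg:
  assumes "elliptic V adj e" "int_supported V x" "\<And>v. v \<in> V \<Longrightarrow> x v \<ge> 0" "v \<in> V" "x v \<noteq> 0"
  shows "int_chi V adj e x \<ge> 0"
proof -
  have "(\<lambda>v. of_int (x v)) \<in> latL V" "lpos V (\<lambda>v. of_int (x v))"
    using assms by (auto simp: latL_def lpos_def supported_def int_supported_def)
  then show ?thesis using assms(1) by (auto simp: elliptic_def int_chi_def)
qed

text \<open>Adding a vertex adjacent to the support keeps \<open>\<chi> = 0\<close>, because it cannot increase \<open>\<chi>\<close>.\<close>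
lemma elliptic_cycle_through:
  assumes ell: "elliptic V adj e" and u: "u \<in> V"
  shows "\<exists>x. int_supported V x \<and> (\<forall>v. x v \<ge> 0) \<and> int_chi V adj e x = 0 \<and> x u \<ge> 1"
proof -
  let ?P = "\<lambda>x v. int_supported V x \<and> (\<forall>v. x v \<ge> 0) \<and> int_chi V adj e x = 0 \<and> x v \<ge> (1::int)"
  have t: "decorated_tree V adj e" using ell by (simp add: elliptic_def)
  obtain l where l: "l \<in> latL V" "lpos V l" "chi V adj e l = 0" using ell by (auto simp: elliptic_def)
  define x where "x v = \<lfloor>l v\<rfloor>" for v
  have lx: "l v = of_int (x v)" for v
    using l(1) unfolding latL_def supported_def x_def by (cases "v \<in> V") (auto elim: Ints_cases)
  then have lx': "l = (\<lambda>v. of_int (x v))" by blast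
  obtain v0 where v0: "v0 \<in> V" "l v0 \<noteq> 0" using l(2) by (auto simp: lpos_def)
  have sup: "int_supported V x" using l(1) by (auto simp: latL_def supported_def x_def int_supported_def)
  have nn: "x v \<ge> 0" for v
    using l(2) sup by (cases "v \<in> V") (auto simp: lpos_def lx int_supported_def)
  have "x v0 \<noteq> 0" using v0 by (simp add: lx)
  with nn[of v0] have "x v0 \<ge> 1" by linarith
  then have start: "\<exists>x. ?P x v0" using sup nn l(3) unfolding lx' int_chi_def by blast
  \<comment> \<open>The support is extended along a path from \<open>v0\<close> to \<open>u\<close>,
    one vertex at a time.\<close>
  have "(\<lambda>a b. a \<in> V \<and> b \<in> V \<and> adj a b)\<^sup>*\<^sup>* v0 u"
    using t v0(1) u by (auto simp: decorated_tree_def)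
  then show ?thesis
  proof (induction rule: rtranclp_induct)
    case base
    show ?case by (rule start)
  next
    case (step a b)
    then obtain x where x: "int_supported V x" "\<And>v. x v \<ge> 0" "int_chi V adj e x = 0" "x a \<ge> 1" by blast
    have ab: "a \<in> V" "b \<in> V" "adj b a" using step.hyps(2) tree_sym[OF t] by auto
    show ?case
    proof (cases "x b \<ge> 1")
      case True
      then show ?thesis using x by blast
    next
      case False
      with x(2)[of b] have xb: "x b = 0" by linarith
      let ?y = "x(b := x b + 1)"
      \<comment> \<open>The vertex \<open>b\<close> is outside the support but adjacent to
        \<open>a\<close> inside it, so the pairing is at least 1 and adding \<open>b\<close> cannot
        raise \<chi>.\<close>
      have "x a \<le> (\<Sum>w | w \<in> V \<and> adj b w. x w)"
        using ab x(2) tree_finite[OF t] by (intro member_le_sum) auto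
      then have "pairing V adj e x b \<ge> 1" using x(4) xb by (simp add: pairing_def)
      then have "int_chi V adj e ?y \<le> 0"
        unfolding int_chi_increment[OF t ab(2)] x(3) by simp
      moreover have "int_supported V ?y" "\<forall>v. ?y v \<ge> 0" "?y b = 1"
        using x xb ab by (auto simp: int_supported_def)
      moreover from this have "int_chi V adj e ?y \<ge> 0"
        by (intro elliptic_int_chi_nonneg[OF ell, of ?y b]) (use ab x(2) in auto)
      ultimately have "?P ?y b" using x(2) by simp
      then show ?thesis by blast
    qed
  qed
qed

text \<open>Otherwise \<open>\<chi>(C + 2 E\<^sub>w + \<Sum>\<^sub>c E\<^sub>c) < 0\<close> for an elliptic cycle \<open>C\<close> on \<open>V\<close> passing through \<open>u\<close>.\<close>
lemma elliptic_branch_bound: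
  assumes ell: "elliptic V adj e" and ell': "elliptic V' adj e" and sub: "V \<subseteq> V'"
    and u: "u \<in> V" and w: "w \<in> V' - V" and nbr_w: "\<And>x. x \<in> V \<Longrightarrow> adj w x \<longleftrightarrow> x = u"
    and C: "C \<subseteq> V' - V" "w \<notin> C" and nbr_C: "\<And>c x. c \<in> C \<Longrightarrow> x \<in> V' \<Longrightarrow> adj c x \<longleftrightarrow> x = w"
  shows "int (card C) \<le> - e w"
proof -
  have t: "decorated_tree V adj e" and t': "decorated_tree V' adj e"
    using ell ell' by (auto simp: elliptic_def)
  have fin: "finite V'" "finite C" using tree_finite[OF t'] C finite_subset by blast+
  obtain x where x: "int_supported V x" "\<And>v. x v \<ge> 0" "int_chi V adj e x = 0" "x u \<ge> 1"
    using elliptic_cycle_through[OF ell u] by blast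
  have x_out: "v \<notin> V \<Longrightarrow> x v = 0" for v using x(1) by (auto simp: int_supported_def)
  have w': "w \<in> V'" and xw: "x w = 0" using w x_out by auto
  \<comment> \<open>This is \<open>x\<close> plus one copy of \<open>w\<close> and of each vertex in
    \<open>S\<close>; \<open>x\<close> vanishes on all of them when
    \<open>S \<subseteq> C\<close>.\<close>
  define y where "y S = (\<lambda>v. if v \<in> S then 1 else (x(w := x w + 1)) v)" for S
  \<comment> \<open>Adding \<open>w\<close> changes \<chi> by \<open>1 - x u\<close>. Each
    \<open>c\<close> then pairs to 1 with the cycle, so adding it leaves \<chi> unchanged.\<close>
  have chi_y: "int_chi V' adj e (y S) = 1 - of_int (x u)" if "finite S" "S \<subseteq> C" for S
    using that
  proof (induction S rule: finite_induct)
    case empty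
    have "(\<Sum>v | v \<in> V' \<and> adj w v. x v) = (\<Sum>v\<in>{u}. x v)"
      using fin u sub nbr_w by (intro sum.mono_neutral_right) (auto intro!: x_out)
    then have "pairing V' adj e x w = x u" using xw by (simp add: pairing_def)
    then have "int_chi V' adj e (x(w := x w + 1)) = 1 - of_int (x u)"
      using int_chi_increment[OF t' w', of x] int_chi_mono_set[OF t t' sub x(1)] x(3) by simp
    moreover have "y {} = x(w := x w + 1)" by (auto simp: y_def)
    ultimately show ?case by argo
  next
    case (insert c S)
    have c: "c \<in> V'" "c \<noteq> w" "w \<notin> S" "x c = 0" using insert C x_out by auto
    have "{v. v \<in> V' \<and> adj c v} = {w}" using insert nbr_C w' by auto
    then have "pairing V' adj e (y S) c = 1"
      using c insert.hyps xw by (simp add: pairing_def y_def)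
    moreover have "y (insert c S) = (y S)(c := y S c + 1)"
      using c insert.hyps by (auto simp: y_def fun_eq_iff)
    moreover have "int_chi V' adj e (y S) = 1 - of_int (x u)" using insert by simp
    ultimately show ?case using int_chi_increment[OF t' c(1), of "y S"] by (metis add_diff_cancel_right' of_int_1)
  qed
  have yw: "y C w = 1" using C xw by (simp add: y_def)
  have y_nn: "y C v \<ge> 0" for v using x(2) by (simp add: y_def)
  have uC: "u \<notin> C" "u \<noteq> w" using u w C by auto
  have "x u + int (card C) = (\<Sum>v\<in>insert u C. y C v)"
    using fin uC by (simp add: y_def)
  also have "\<dots> \<le> (\<Sum>v | v \<in> V' \<and> adj w v. y C v)"
  proof (rule sum_mono2)
    show "insert u C \<subseteq> {v. v \<in> V' \<and> adj w v}"
      using u sub C w' nbr_w nbr_C tree_sym[OF t'] by blast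
  qed (use fin y_nn in auto)
  finally have "pairing V' adj e (y C) w \<ge> e w + x u + int (card C)"
    by (simp add: pairing_def yw)
  \<comment> \<open>A second copy of \<open>w\<close> is added. Nonnegativity of \<chi> yields
    \<open>e w + x u + int (card C) \<le> 2 - x u\<close>, and \<open>x u \<ge> 1\<close>
    finishes.\<close>
  moreover have "int_chi V' adj e ((y C)(w := y C w + 1)) \<ge> 0"
  proof (rule elliptic_int_chi_nonneg[OF ell' _ _ w'])
    show "int_supported V' ((y C)(w := y C w + 1))"
      using C w' x_out sub by (auto simp: int_supported_def y_def)
  qed (use y_nn yw in auto)
  then have "of_int (pairing V' adj e (y C) w) \<le> (of_int (2 - x u) :: rat)"
    unfolding int_chi_increment[OF t' w'] chi_y[OF fin(2) subset_refl] by simp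
  then have "pairing V' adj e (y C) w \<le> 2 - x u" by (simp only: of_int_le_iff)
  ultimately show ?thesis using x(4) by linarith
qed

section \<open>Points without extension\<close>

text \<open>Raising the argument by 1 raises each quotient by at most 1, and there are at most
  \<open>b\<close> quotients.\<close>

lemma div_sum_decreasing:
  fixes f :: "'a \<Rightarrow> int"
  assumes "\<And>c. c \<in> C \<Longrightarrow> f c \<ge> 1" "int (card C) \<le> b" "a \<le> a'"
  shows "(\<Sum>c\<in>C. (a' - 1) div f c) - b * a' \<le> (\<Sum>c\<in>C. (a - 1) div f c) - b * a"
  using assms(3)
proof (induction a' rule: int_ge_induct)
  case (step i)
  have "(\<Sum>c\<in>C. (i + 1 - 1) div f c) \<le> (\<Sum>c\<in>C. (i - 1) div f c + 1)"
  proof (rule sum_mono)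
    fix c assume c: "c \<in> C"
    have "i \<le> (i - 1) + f c" using assms(1)[OF c] by simp
    then have "i div f c \<le> ((i - 1) + f c) div f c" using assms(1)[OF c] by (intro zdiv_mono1) auto
    then show "(i + 1 - 1) div f c \<le> (i - 1) div f c + 1" using assms(1)[OF c] by simp
  qed
  then show ?case using step assms(2) by (simp add: sum.distrib algebra_simps)
qed simp

lemma sum_weight_empty_fibre:
  fixes V0 V1 V2 :: "'a set"
  assumes ell0: "elliptic V0 adj e" and ell2: "elliptic V2 adj e"
    and g1: "end_glued V0 V1 adj e u" and g2: "end_glued V1 V2 adj e u'"
    and x0: "int_supported V0 x0" "weight V0 adj e x0 \<noteq> 0"
    and y: "y \<in> fibre V0 V2 adj e x0"
  shows "(\<Sum>x | x \<in> fibre V0 V1 adj e x0 \<and> fibre V1 V2 adj e x = {}. weight V1 adj e x) = 0"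
proof -
  interpret A: end_glued V0 V1 adj e u by (rule g1)
  interpret B: end_glued V1 V2 adj e u' by (rule g2)
  let ?F = "fibre V0 V1 adj e x0"
  let ?NE = "{x. x \<in> ?F \<and> fibre V1 V2 adj e x = {}}"
  have yw: "weight V2 adj e y \<noteq> 0" and yx: "\<And>v. v \<in> V0 \<Longrightarrow> y v = x0 v"
    using y by (auto simp: fibre_def int_restr_def)
  have u'2: "u' \<in> V2" using B.u(1) B.sub by blast
  have "(\<Sum>c\<in>V2 - V1. y c) \<le> (\<Sum>c\<in>V2 - V1. B.bound y c)"
    using B.vertex_factor_newD[OF B.weight_nonzeroD[OF yw]] by (intro sum_mono) auto
  \<comment> \<open>The inequality is read off the local factors of \<open>y\<close> directly, since
    the weight of \<open>y\<close> on \<open>V1\<close> is not known to be nonzero.\<close>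
  then have y_ext: "B.s - 1 + pairing V1 adj e y u' + (\<Sum>c\<in>V2 - V1. B.bound y c) \<ge> 0"
    using B.vertex_factor_uD[OF B.weight_nonzeroD[OF yw u'2]] by linarith
  show ?thesis
  proof (cases "u' \<in> V0")
    case True
    \<comment> \<open>In \<open>V1\<close> the vertex \<open>u\<close> has valency at least 2, so it
      is no longer an end. Hence the first gluing does not touch the pairing at
      \<open>u'\<close>.\<close>
    have "u' \<noteq> u" using A.valency_u A.s_pos B.u(2) by auto
    with True have u': "u' \<in> V0 - {u}" by blast
    have "fibre V1 V2 adj e x \<noteq> {}" if x: "x \<in> ?F" for x
    proof -
      have "pairing V0 adj e x u' = pairing V0 adj e y u'"
        using True A.fibreD(2)[OF x] yx by (intro pairing_cong) auto
      moreover have "x u' = y u'" using True A.fibreD(2)[OF x] yx by simp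
      ultimately show ?thesis
        using B.fibre_nonempty_iff[OF A.fibreD(3)[OF x] A.fibreD(1)[OF x]] y_ext
        by (simp add: A.pairing_old[OF u'] B.bound_def)
    qed
    then have "?NE = {}" by blast
    then show ?thesis by (simp only: sum.empty)
  next
    case False
    then have u': "u' \<in> V1 - V0" using B.u(1) by blast
    let ?W = "V1 - V0 - {u'}"
    \<comment> \<open>The extension criterion for a point with value \<open>a\<close> at
      \<open>u'\<close>, whose only neighbour in \<open>V1\<close> is \<open>u\<close>.\<close>
    define N where "N a = B.s - 1 + (e u' * a + x0 u) + (\<Sum>c\<in>V2 - V1. (a - 1) div (- e c))" for a
    \<comment> \<open>The value at \<open>u'\<close> for which the exponent at \<open>u\<close> is 0
      when all other new coordinates attain their bounds.\<close>
    define a0 where "a0 = - (A.s - 1 + pairing V0 adj e x0 u + (\<Sum>v\<in>?W. A.bound x0 v))"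
    have bound_y: "A.bound y v = A.bound x0 v" for v using yx A.u by (simp add: A.bound_def)
    have ne_iff: "fibre V1 V2 adj e x \<noteq> {} \<longleftrightarrow> N (x u') \<ge> 0" if x: "x \<in> ?F" for x
      unfolding B.fibre_nonempty_iff[OF A.fibreD(3)[OF x] A.fibreD(1)[OF x]]
      using A.fibreD(2)[OF x A.u(1)] by (simp add: A.pairing_new[OF u'] N_def B.bound_def)
    have N_y: "N (y u') \<ge> 0"
      using y_ext yx[OF A.u(1)] by (simp add: A.pairing_new[OF u'] N_def B.bound_def)
    have "a0 \<le> y u'"
    proof -
      \<comment> \<open>Only the factor at \<open>u'\<close> is lost in passing from
        \<open>V2\<close> to \<open>V1\<close>; the factors at \<open>u\<close> and at the other new
        vertices suffice.\<close>
      have nz: "vertex_factor V1 adj e y v \<noteq> 0" if "v \<in> V1 - {u'}" for v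
        using B.vertex_factor_below[OF yw that] .
      have "u \<in> V1 - {u'}" using A.u A.sub u' by blast
      then have "A.s - 1 + pairing V0 adj e y u + (\<Sum>v\<in>V1 - V0. y v) \<ge> 0"
        using A.vertex_factor_uD nz by blast
      moreover have "(\<Sum>v\<in>V1 - V0. y v) = y u' + (\<Sum>v\<in>?W. y v)"
        by (rule sum.remove[OF A.fin(3) u'])
      moreover have "(\<Sum>v\<in>?W. y v) \<le> (\<Sum>v\<in>?W. A.bound x0 v)"
        using A.vertex_factor_newD[OF nz] by (intro sum_mono) (auto simp: bound_y)
      moreover have "pairing V0 adj e y u = pairing V0 adj e x0 u"
        using yx A.u by (intro pairing_cong)
      ultimately show ?thesis by (simp add: a0_def)
    qed
    \<comment> \<open>The branch at \<open>u'\<close> meets an elliptic cycle on \<open>V0\<close>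
      through \<open>u\<close>.\<close>
    moreover have "int (card (V2 - V1)) \<le> - e u'"
    proof (rule elliptic_branch_bound[OF ell0 ell2 _ A.u(1)])
      show "adj u' x \<longleftrightarrow> x = u" if "x \<in> V0" for x using A.glued[OF u'] that A.sub by blast
      show "adj c x \<longleftrightarrow> x = u'" if "c \<in> V2 - V1" "x \<in> V2" for c x using B.glued that by blast
    qed (use A.sub B.sub u' in auto)
    moreover have "- e c \<ge> 1" if "c \<in> V2 - V1" for c using B.e_neg[OF that] by simp
    ultimately have "N a0 \<ge> N (y u')"
      using div_sum_decreasing[of "V2 - V1" "\<lambda>c. - e c" "- e u'" a0 "y u'"] by (simp add: N_def)
    then have N_a0: "N a0 \<ge> 0" using N_y by linarith
    have finNE: "finite ?NE" using A.finite_fibre[OF x0(2)] by simp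
    have "(\<Sum>x\<in>?NE. weight V1 adj e x) =
        (\<Sum>a\<in>(\<lambda>x. x u') ` ?NE. \<Sum>x | x \<in> ?NE \<and> x u' = a. weight V1 adj e x)"
      by (rule sum.image_gen[OF finNE])
    also have "\<dots> = 0"
    proof (rule sum.neutral, intro ballI)
      fix a assume "a \<in> (\<lambda>x. x u') ` ?NE"
      then have Na: "N a < 0" using ne_iff by fastforce
      \<comment> \<open>Extendability depends on \<open>a\<close> alone, so a slice of
        \<open>?NE\<close> is a full slice of the fibre.\<close>
      then have "{x. x \<in> ?NE \<and> x u' = a} = {x. x \<in> ?F \<and> x u' = a}" using ne_iff by fastforce
      moreover have "A.s - 1 + pairing V0 adj e x0 u + a + (\<Sum>v\<in>?W. A.bound x0 v) \<noteq> 0"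
      proof
        assume "A.s - 1 + pairing V0 adj e x0 u + a + (\<Sum>v\<in>?W. A.bound x0 v) = 0"
        then have "a = a0" unfolding a0_def by linarith
        then show False using Na N_a0 by simp
      qed
      ultimately show "(\<Sum>x | x \<in> ?NE \<and> x u' = a. weight V1 adj e x) = 0"
        using A.fibre_slice_sum[OF x0(2) u' x0(1)] by simp
    qed
    finally show ?thesis .
  qed
qed

section \<open>Return to dual lattice points and the original fibres\<close>

lemma end_attachment_glued:
  assumes "elliptic V' adj e" "end_attachment V V' adj"
  obtains u where "end_glued V V' adj e u"
proof -
  obtain u where "u \<in> V" "valency V adj u = 1" "\<forall>w\<in>V' - V. \<forall>x\<in>V'. adj w x \<longleftrightarrow> x = u" "V \<subset> V'"
    using assms(2) unfolding end_attachment_def by blast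
  then have "end_glued V V' adj e u"
    using assms(1) by unfold_locales (auto simp: elliptic_def)
  then show ?thesis by (rule that)
qed

theorem mainTheorem7:
  fixes V0 V1 V2 :: "'a set" and adj :: "'a \<Rightarrow> 'a \<Rightarrow> bool" and e :: "'a \<Rightarrow> int"
    and l :: "'a \<Rightarrow> rat"
  assumes "elliptic V0 adj e" and "elliptic V1 adj e" and "elliptic V2 adj e"
    and "end_attachment V0 V1 adj" and "end_attachment V1 V2 adj"
    and "l \<in> suppP0 V0 adj e"
    and "piC_inv V0 V2 adj e l \<noteq> {}"
  shows "finite {l1 \<in> piC_inv V0 V1 adj e l. piC_inv V1 V2 adj e l1 = {}} \<and>
    (\<Sum>l1\<in>{l1 \<in> piC_inv V0 V1 adj e l. piC_inv V1 V2 adj e l1 = {}}. zG V1 adj e l1) = 0"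
proof -
  have t: "decorated_tree V0 adj e" "decorated_tree V1 adj e" "decorated_tree V2 adj e"
    using assms(1-3) by (auto simp: elliptic_def)
  obtain u where g1: "end_glued V0 V1 adj e u" using end_attachment_glued assms(2,4) .
  obtain u' where g2: "end_glued V1 V2 adj e u'" using end_attachment_glued assms(3,5) .
  have sub: "V0 \<subseteq> V1" "V1 \<subseteq> V2" using assms(4,5) by (auto simp: end_attachment_def)
  obtain x0 where l: "l = dual_point V0 adj e x0" and x0: "int_supported V0 x0"
      "\<exists>v\<in>V0. x0 v \<ge> 0" "weight V0 adj e x0 \<noteq> 0"
    using assms(6) unfolding suppP0_eq[OF t(1)] by blast
  have F: "piC_inv V0 V1 adj e l = dual_point V1 adj e ` fibre V0 V1 adj e x0"
    unfolding l fibre_def by (rule piC_inv_dual_point[OF t(2) sub(1) x0(2)])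
  \<comment> \<open>The nonnegative coordinate of \<open>x0\<close> persists in \<open>x\<close>, so
    the coordinate form of the fibre applies to the second step too.\<close>
  have F2: "piC_inv V1 V2 adj e (dual_point V1 adj e x) = dual_point V2 adj e ` fibre V1 V2 adj e x"
    if x: "x \<in> fibre V0 V1 adj e x0" for x
    unfolding fibre_def
  proof (rule piC_inv_dual_point[OF t(3) sub(2)])
    obtain v where "v \<in> V0" "x0 v \<ge> 0" using x0(2) by blast
    then have "v \<in> V1" "x v \<ge> 0" using end_glued.fibreD(2)[OF g1 x] sub(1) by auto
    then show "\<exists>v\<in>V1. x v \<ge> 0" by blast
  qed
  let ?NE = "{x. x \<in> fibre V0 V1 adj e x0 \<and> fibre V1 V2 adj e x = {}}"
  have NE: "{l1 \<in> piC_inv V0 V1 adj e l. piC_inv V1 V2 adj e l1 = {}} = dual_point V1 adj e ` ?NE"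
    unfolding F using F2 by auto
  have "fibre V0 V2 adj e x0 \<noteq> {}"
    using assms(7) piC_inv_dual_point[OF t(3) _ x0(2)] sub unfolding l fibre_def by blast
  then obtain y where y: "y \<in> fibre V0 V2 adj e x0" by blast
  have "(\<Sum>l1\<in>dual_point V1 adj e ` ?NE. zG V1 adj e l1) = (\<Sum>x\<in>?NE. zG V1 adj e (dual_point V1 adj e x))"
    by (subst sum.reindex) (auto simp: inj_on_def dual_point_inj)
  also have "\<dots> = (\<Sum>x\<in>?NE. weight V1 adj e x)"
    by (intro sum.cong refl zG_dual_point[OF t(2)]) (auto simp: fibre_def)
  also have "\<dots> = 0" by (rule sum_weight_empty_fibre[OF assms(1,3) g1 g2 x0(1,3) y])
  finally show ?thesis
    unfolding NE using end_glued.finite_fibre[OF g1 x0(3)] by simp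
qed

end
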